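(* Let $\tilde l^*$ be a best response pseudo-potential function for the distributionally robust game $\mathcal{G}(m)$, let $z^*$ be a minimizer of $\tilde l^*$, and let $z(t)$, $t\ge 0$, be generated by the Bregman algorithm $$\frac{d}{dt}\left[g_z\big(z+e^{-\alpha}\dot z\big)\right]=-e^{\alpha+\beta}\,\tilde l^*_z(z),\qquad z(0)=z_0,$$ where $\alpha$ is a time-dependent function, $\beta(t)=\beta(0)+\int_0^t e^{\alpha(t')}\,dt'$ and $\beta(0)\ge 0$. If $\tilde l^*$ is convex, then for all $t\ge 0$ $$0\ \le\ \tilde l^*(z(t))-\tilde l^*(z^* )\ \le\ e^{-\beta(t)}\,c_0,$$ where $$c_0=d_g^{BR}\big(z^*,\,z_0+e^{-\alpha(0)}\dot z_0\big)+e^{\beta(0)}\left[\tilde l^*(z(0))-\tilde l^*(z^* )\right],\qquad \dot z_0=\dot z(0).$$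
   Context: Bregman divergence: $g$ is a differentiable strictly convex real-valued function on the (finite-dimensional) domain of the variable $z$, with gradient $g_z$, and $$d_g^{BR}(y,x)=g(y)-g(x)-\langle g_x(x),\,y-x\rangle .$$ $\tilde l^*_z$ denotes the gradient of $\tilde l^*$; dots denote time derivatives; the functions are smooth enough for the differential equation to make sense. Distributionally robust game $\mathcal{G}(m)$: $(\Omega,\mathcal{F},m)$ is a probability space, the players are $j\in\{1,\dots,n\}$, $n\ge2$, with action sets $\mathcal{A}_j$ (subsets of finite-dimensional spaces) and losses $l_j(a,\omega)$. With $f$ convex and proper and $\rho>0$, each player $j$ minimizes over $a_j\in\mathcal{A}_j$ the worst-case loss $\sup_{\tilde m\in B_\rho(m)}\mathbb{E}_{\tilde m}l_j(a,\omega)$, where $B_\rho(m)$ is the set of probability measures $\tilde m\ll m$ with $\int_\Omega f\big(\frac{d\tilde m}{dm}\big)dm-f(1)\le\rho$. The associated finite-dimensional objective of player $j$ is $$l_j^*(z)=l_j^*(a,\lambda,\mu,m)=\lambda(\rho+f(1))+\mu+\int_\Omega\lambda f^*\!\left(\frac{l_j(a,\omega)-\mu}{\lambda}\right)dm(\omega),\qquad z=(a,\lambda,\mu),\ \lambda\ge0,\ \mu\in\mathbb{R},$$ where $f^*(\xi)=\sup_x[\langle x,\xi\rangle-f(x)]$, and $z_j$ denotes the components of $z$ controlled by player $j$. A function $z\mapsto\tilde l^*(z)$ is a best response pseudo-potential function for $\mathcal{G}(m)$ if $\arg\min_{z_j}\tilde l^*(z)\subseteq\arg\min_{z_j}l_j^*(z)$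 for every $j$. *)

theory Defs
  imports "HOL-Probability.Probability_Measure"
begin

section \<open>Convex functions, gradients and the Bregman divergence\<close>

definition strictly_convex_on :: "'a::real_vector set \<Rightarrow> ('a \<Rightarrow> real) \<Rightarrow> bool" where
  "strictly_convex_on S g \<longleftrightarrow> convex S \<and>
     (\<forall>x\<in>S. \<forall>y\<in>S. \<forall>u>0. \<forall>v>0. x \<noteq> y \<longrightarrow> u + v = 1 \<longrightarrow>
        g (u *\<^sub>R x + v *\<^sub>R y) < u * g x + v * g y)"

(* Differentiability is relative to S, so that S may have boundary points (such as a zero
   multiplier). In the interior of S this is the ordinary gradient; if S is contained in a proper
   affine subspace, only the part of G x along that subspace is determined. *)
definition has_gradient_on :: "('a::real_inner \<Rightarrow> real) \<Rightarrow> ('a \<Rightarrow> 'a) \<Rightarrow> 'a set \<Rightarrow> bool" where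
  "has_gradient_on F G S \<longleftrightarrow>
     (\<forall>x\<in>S. (F has_derivative (\<lambda>h. inner (G x) h)) (at x within S))"

definition bregman_divergence ::
    "('a::real_inner \<Rightarrow> real) \<Rightarrow> ('a \<Rightarrow> 'a) \<Rightarrow> 'a \<Rightarrow> 'a \<Rightarrow> real" where
  "bregman_divergence g gz y x = g y - g x - inner (gz x) (y - x)"

definition convex_proper :: "(real \<Rightarrow> ereal) \<Rightarrow> bool" where
  "convex_proper f \<longleftrightarrow>
     (\<forall>x y u v. 0 \<le> u \<longrightarrow> 0 \<le> v \<longrightarrow> u + v = 1 \<longrightarrow>
        f (u * x + v * y) \<le> ereal u * f x + ereal v * f y) \<and>
     (\<forall>x. f x \<noteq> - \<infinity>) \<and> (\<exists>x. f x \<noteq> \<infinity>)"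

definition conjugate :: "(real \<Rightarrow> ereal) \<Rightarrow> real \<Rightarrow> ereal" where
  "conjugate f \<xi> = (SUP x. ereal (x * \<xi>) - f x)"

(* The expression lam * f^*(s / lam). For lam > 0 it equals SUP x. x * s - lam * f x, the supremum
   being over the points where f is finite; at lam = 0 it is read as that supremum (the usual closed
   perspective), and not by means of s / 0 = 0. For f with domain [0, \<infinity>) the value at lam = 0 is
   0 if s \<le> 0, and \<infinity> otherwise. *)
definition conjugate_perspective :: "(real \<Rightarrow> ereal) \<Rightarrow> real \<Rightarrow> real \<Rightarrow> ereal" where
  "conjugate_perspective f lam s =
     (if lam > 0 then ereal lam * conjugate f (s / lam)
      else (SUP x\<in>{x. f x < \<infinity>}. ereal (x * s)))"

(* Positive part minus negative part; the value is \<infinity> whenever the positive part has infinite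
   integral, since \<infinity> - \<infinity> = \<infinity> in ereal. *)
definition ereal_integral :: "'w measure \<Rightarrow> ('w \<Rightarrow> ereal) \<Rightarrow> ereal" where
  "ereal_integral M h =
     enn2ereal (\<integral>\<^sup>+ w. e2ennreal (h w) \<partial>M) - enn2ereal (\<integral>\<^sup>+ w. e2ennreal (- h w) \<partial>M)"


section \<open>Distributionally robust games\<close>

(* Players are the elements of 'n. The action spaces of the players may have different dimensions:
   'd indexes the coordinates of all players' actions taken together, and coordinate i belongs to
   player (owner i). Player j's action is the vector that keeps j's coordinates and is 0 at
   all the others, and the action set A j consists of such vectors. *)
definition action_of :: "('d::finite \<Rightarrow> 'n) \<Rightarrow> 'n \<Rightarrow> real^'d \<Rightarrow> real^'d" where
  "action_of owner j a = (\<chi> i. if owner i = j then a $ i else 0)"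

definition action_profiles :: "('d::finite \<Rightarrow> 'n) \<Rightarrow> ('n \<Rightarrow> (real^'d) set) \<Rightarrow> (real^'d) set" where
  "action_profiles owner A = {a. \<forall>j. action_of owner j a \<in> A j}"

locale robust_game = prob_space M
  for M :: "'w measure" +
  fixes f :: "real \<Rightarrow> ereal"
    and \<rho> :: real
    and owner :: "'d::finite \<Rightarrow> 'n::finite"
    and A :: "'n \<Rightarrow> (real^'d) set"
    and l :: "'n \<Rightarrow> real^'d \<Rightarrow> 'w \<Rightarrow> real"
  assumes two_players: "CARD('n) \<ge> 2"
    and f_convex_proper: "convex_proper f"
    and rho_pos: "\<rho> > 0"
    and action_sets: "A j \<subseteq> range (action_of owner j)"
    and loss_measurable: "a \<in> action_profiles owner A \<Longrightarrow> l j a \<in> borel_measurable M"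

definition divergence_ball :: "'w measure \<Rightarrow> (real \<Rightarrow> ereal) \<Rightarrow> real \<Rightarrow> 'w measure set" where
  "divergence_ball M f \<rho> =
     {Q. prob_space Q \<and> sets Q = sets M \<and> absolutely_continuous M Q \<and>
         ereal_integral M (\<lambda>w. f (enn2real (RN_deriv M Q w))) - f 1 \<le> ereal \<rho>}"

(* The loss that player j minimizes in the game itself. The best response condition below is stated
   through dual_objective, its finite-dimensional counterpart. *)
definition worst_case_loss ::
    "'w measure \<Rightarrow> (real \<Rightarrow> ereal) \<Rightarrow> real \<Rightarrow> ('n \<Rightarrow> real^'d \<Rightarrow> 'w \<Rightarrow> real) \<Rightarrow> 'n \<Rightarrow> real^'d \<Rightarrow> ereal" where
  "worst_case_loss M f \<rho> l j a =
     (SUP Q\<in>divergence_ball M f \<rho>. ereal_integral Q (\<lambda>w. ereal (l j a w)))"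

(* z = (a, lam, mu). The multipliers come from the worst-case problem of a single player, hence
   lam and mu have one component for each player. *)
type_synonym ('d, 'n) variable = "(real, 'd) vec \<times> (real, 'n) vec \<times> (real, 'n) vec"

definition feasible ::
    "('d::finite \<Rightarrow> 'n::finite) \<Rightarrow> ('n \<Rightarrow> (real^'d) set) \<Rightarrow> ('d, 'n) variable set" where
  "feasible owner A = {(a, lam, mu). a \<in> action_profiles owner A \<and> (\<forall>j. 0 \<le> lam $ j)}"

definition dual_objective ::
    "'w measure \<Rightarrow> (real \<Rightarrow> ereal) \<Rightarrow> real \<Rightarrow> ('n::finite \<Rightarrow> real^'d \<Rightarrow> 'w \<Rightarrow> real) \<Rightarrow> 'n \<Rightarrow>
     ('d::finite, 'n) variable \<Rightarrow> ereal" where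
  "dual_objective M f \<rho> l j = (\<lambda>(a, lam, mu).
     ereal (lam $ j) * (ereal \<rho> + f 1) + ereal (mu $ j) +
     ereal_integral M (\<lambda>w. conjugate_perspective f (lam $ j) (l j a w - mu $ j)))"

(* The points that differ from z at most in the components z_j = (a_j, lam_j, mu_j). *)
definition deviations ::
    "('d::finite \<Rightarrow> 'n::finite) \<Rightarrow> 'n \<Rightarrow> ('d, 'n) variable \<Rightarrow> ('d, 'n) variable set" where
  "deviations owner j = (\<lambda>(a, lam, mu).
     {(a', lam', mu'). (\<forall>i. owner i \<noteq> j \<longrightarrow> a' $ i = a $ i) \<and>
        (\<forall>k. k \<noteq> j \<longrightarrow> lam' $ k = lam $ k \<and> mu' $ k = mu $ k)})"

(* The argmin over z_j with the remaining components of z held fixed; a value of z_j is represented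
   by the full point obtained by substituting it into z. *)
definition player_argmin ::
    "('d::finite \<Rightarrow> 'n::finite) \<Rightarrow> ('n \<Rightarrow> (real^'d) set) \<Rightarrow> 'n \<Rightarrow>
     (('d, 'n) variable \<Rightarrow> 'b::ord) \<Rightarrow> ('d, 'n) variable \<Rightarrow> ('d, 'n) variable set" where
  "player_argmin owner A j F z =
     {z'. is_arg_min F (\<lambda>y. y \<in> feasible owner A \<inter> deviations owner j z) z'}"

definition best_response_pseudo_potential ::
    "'w measure \<Rightarrow> (real \<Rightarrow> ereal) \<Rightarrow> real \<Rightarrow> ('d::finite \<Rightarrow> 'n::finite) \<Rightarrow> ('n \<Rightarrow> (real^'d) set) \<Rightarrow>
     ('n \<Rightarrow> real^'d \<Rightarrow> 'w \<Rightarrow> real) \<Rightarrow> (('d, 'n) variable \<Rightarrow> real) \<Rightarrow> bool" where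
  "best_response_pseudo_potential M f \<rho> owner A l P \<longleftrightarrow>
     (\<forall>j. \<forall>z\<in>feasible owner A.
        player_argmin owner A j P z \<subseteq> player_argmin owner A j (dual_objective M f \<rho> l j) z)"


section \<open>The Bregman algorithm\<close>

(* Z is the domain of the objective with gradient Pz, and D the domain of g. The dynamics
   requires z to stay in Z, and z + exp (- alpha) z' to stay in D. Derivatives at time 0 are
   one-sided. *)
definition bregman_algorithm ::
    "'a::real_normed_vector set \<Rightarrow> 'a set \<Rightarrow> ('a \<Rightarrow> 'a) \<Rightarrow> ('a \<Rightarrow> 'a) \<Rightarrow> (real \<Rightarrow> real) \<Rightarrow> (real \<Rightarrow> real) \<Rightarrow>
     'a \<Rightarrow> (real \<Rightarrow> 'a) \<Rightarrow> (real \<Rightarrow> 'a) \<Rightarrow> bool" where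
  "bregman_algorithm Z D gz Pz \<alpha> \<beta> z0 z zdot \<longleftrightarrow>
     z 0 = z0 \<and>
     (\<forall>t\<ge>0. z t \<in> Z \<and> z t + exp (- \<alpha> t) *\<^sub>R zdot t \<in> D \<and>
        (z has_vector_derivative zdot t) (at t within {0..}) \<and>
        ((\<lambda>s. gz (z s + exp (- \<alpha> s) *\<^sub>R zdot s)) has_vector_derivative
           - exp (\<alpha> t + \<beta> t) *\<^sub>R Pz (z t)) (at t within {0..}))"

end

theory Submission
  imports Defs
begin

text \<open>Write \<open>w = z + exp (- \<alpha>) z'\<close> for the extrapolated point. The bound follows from the Lyapunov
  function \<open>V = d(zmin, w) + exp \<beta> (P z - P zmin)\<close>, where \<open>d\<close> is the Bregman divergence of \<open>g\<close>:
  its initial value is \<open>c0\<close>, and it dominates \<open>exp \<beta> (P z - P zmin)\<close> because \<open>d\<close> is nonnegative.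

  That \<open>V\<close> does not increase comes from the formula \<open>d/dt d(y, w) = - \<langle>d/dt g\<^sub>z(w), y - w\<rangle>\<close>
  (\<open>bregman_divergence_has_derivative\<close>). With the equation of motion and \<open>\<beta>' = exp \<alpha>\<close>, the terms that
  contain the velocity cancel, and
  \<open>V' = exp (\<alpha> + \<beta>) (P z + \<langle>P\<^sub>z(z), zmin - z\<rangle> - P zmin)\<close>,
  which is nonpositive because the graph of the convex function \<open>P\<close> lies above its tangent planes
  (\<open>convex_on_above_tangent\<close>).

  The velocity is only continuous, so \<open>w\<close> and \<open>g \<circ> w\<close> may fail to be differentiable, although
  \<open>g\<^sub>z \<circ> w\<close> is differentiable. The derivative of \<open>d(y, w)\<close> is therefore not obtained from the chain
  rule, but from an exact three-point identity whose remainder is controlled by convexity of \<open>g\<close>.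
  The upper bound (\<open>bregman_algorithm_convergence_rate\<close>) is an inequality about a convex
  differentiable objective on an inner product space and a point \<open>x\<close> of the domain that takes the
  role of \<open>zmin\<close>. The lower bound is the minimality of \<open>zmin\<close>.\<close>

lemma convex_on_if_strictly_convex_on:
  assumes "strictly_convex_on S g"
  shows "convex_on S g"
proof (rule convex_onI)
  show "convex S"
    using assms by (simp add: strictly_convex_on_def)
next
  fix t x y
  assume t: "0 < t" "t < (1::real)" and xy: "x \<in> S" "y \<in> S"
  show "g ((1 - t) *\<^sub>R x + t *\<^sub>R y) \<le> (1 - t) * g x + t * g y"
  proof (cases "x = y")
    case True
    then show ?thesis
      by (simp add: algebra_simps)
  next
    case False
    have "1 - t > 0" "1 - t + t = 1"
      using t by auto
    then show ?thesis
      using assms xy t False unfolding strictly_convex_on_def by (metis less_imp_le)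
  qed
qed

text \<open>A gradient relative to \<open>S\<close> is only determined along directions that stay in \<open>S\<close>. This is
  enough here, since the segment from \<open>x\<close> to \<open>y\<close> lies in \<open>S\<close>: along it the difference quotients at
  \<open>x\<close> are at most \<open>F y - F x\<close>, and so is their limit.\<close>

lemma convex_on_above_tangent:
  assumes convex: "convex_on S F" and grad: "has_gradient_on F G S"
    and x: "x \<in> S" and y: "y \<in> S"
  shows "F x + inner (G x) (y - x) \<le> F y"
proof -
  define c where "c t = x + t *\<^sub>R (y - x)" for t :: real
  have c_alt: "c t = (1 - t) *\<^sub>R x + t *\<^sub>R y" for t
    by (simp add: c_def algebra_simps)
  have in_S: "c ` {0..1} \<subseteq> S"
    using convex_on_imp_convex[OF convex] x y by (auto simp: c_alt convexD)
  have c': "(c has_derivative (\<lambda>t. t *\<^sub>R (y - x))) (at 0 within {0..1})"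
    unfolding c_def by (auto intro!: derivative_eq_intros)
  have "(F has_derivative inner (G (c 0))) (at (c 0) within S)"
    using grad x by (simp add: has_gradient_on_def c_def)
  then have "(F has_derivative inner (G (c 0))) (at (c 0) within c ` {0..1})"
    using in_S by (rule has_derivative_subset)
  from diff_chain_within[OF c' this]
  have "((F \<circ> c) has_real_derivative inner (G x) (y - x)) (at 0 within {0..1})"
    by (simp add: has_field_derivative_def o_def c_def mult_commute_abs)
  then have "((\<lambda>t. (F (c t) - F (c 0)) / (t - 0)) \<longlongrightarrow> inner (G x) (y - x)) (at 0 within {0..1})"
    by (simp add: has_field_derivative_iff)
  moreover have "\<forall>\<^sub>F t in at 0 within {0..1}. (F (c t) - F (c 0)) / (t - 0) \<le> F y - F x"
    unfolding eventually_at_topological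
  proof (intro exI[of _ UNIV] conjI ballI impI)
    fix t :: real
    assume "t \<noteq> 0" "t \<in> {0..1}"
    then have t: "0 < t" "t \<le> 1"
      by auto
    then have "F (c t) \<le> (1 - t) * F x + t * F y"
      using convex_onD[OF convex, of t x y] x y by (simp add: c_alt)
    then have "F (c t) - F (c 0) \<le> (F y - F x) * t"
      by (simp add: c_def algebra_simps)
    then show "(F (c t) - F (c 0)) / (t - 0) \<le> F y - F x"
      using t by (simp add: pos_divide_le_eq)
  qed auto
  moreover have "at 0 within {0..1::real} \<noteq> bot"
    by (simp add: at_within_Icc_at_right)
  ultimately have "inner (G x) (y - x) \<le> F y - F x"
    by (rule tendsto_upperbound)
  then show ?thesis
    by simp
qed

lemma bregman_divergence_nonneg:
  assumes "convex_on D g" "has_gradient_on g gz D" "x \<in> D" "y \<in> D"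
  shows "0 \<le> bregman_divergence g gz y x"
  using convex_on_above_tangent[OF assms] by (simp add: bregman_divergence_def)

lemma bregman_divergence_three_points:
  "bregman_divergence g gz y x' - bregman_divergence g gz y x =
     bregman_divergence g gz x x' - inner (gz x' - gz x) (y - x)"
  by (simp add: bregman_divergence_def inner_diff_left inner_diff_right)

lemma bregman_divergence_symmetrized:
  "bregman_divergence g gz x x' + bregman_divergence g gz x' x =
     inner (gz x' - gz x) (x' - x)"
  by (simp add: bregman_divergence_def inner_diff_left inner_diff_right)

lemma has_vector_derivative_imp_quotient_tendsto:
  assumes "(f has_vector_derivative p) (at t within T)"
  shows "((\<lambda>s. (f s - f t) /\<^sub>R (s - t)) \<longlongrightarrow> p) (at t within T)"
proof -
  have "((\<lambda>s. norm ((f s - f t) - (s - t) *\<^sub>R p) / norm (s - t)) \<longlongrightarrow> 0) (at t within T)"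
    using assms by (simp add: has_vector_derivative_def has_derivative_iff_norm)
  moreover have "\<forall>\<^sub>F s in at t within T.
      norm ((f s - f t) - (s - t) *\<^sub>R p) / norm (s - t) = norm ((f s - f t) /\<^sub>R (s - t) - p)"
    unfolding eventually_at_topological
  proof (intro exI[of _ UNIV] conjI ballI impI)
    fix s
    assume "s \<noteq> t"
    then have "(f s - f t) /\<^sub>R (s - t) - p = ((f s - f t) - (s - t) *\<^sub>R p) /\<^sub>R (s - t)"
      by (simp add: scaleR_diff_right)
    then show "norm ((f s - f t) - (s - t) *\<^sub>R p) / norm (s - t) = norm ((f s - f t) /\<^sub>R (s - t) - p)"
      by (simp add: divide_inverse mult.commute)
  qed auto
  ultimately have "((\<lambda>s. norm ((f s - f t) /\<^sub>R (s - t) - p)) \<longlongrightarrow> 0) (at t within T)"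
    by (rule Lim_transform_eventually)
  then show ?thesis
    by (simp add: tendsto_norm_zero_iff LIM_zero_iff)
qed

text \<open>By the three-point identity, the difference quotient of \<open>d(y, w)\<close> is that of the linear term
  up to \<open>d(w t, w s) / (s - t)\<close>. This remainder vanishes as \<open>s\<close> tends to \<open>t\<close>: the divergence is
  nonnegative and at most its symmetrization, which is the inner product of an increment of
  \<open>g\<^sub>z \<circ> w\<close>, of order \<open>s - t\<close>, with an increment of \<open>w\<close>, which tends to \<open>0\<close>.\<close>

lemma bregman_divergence_has_derivative:
  assumes convex: "convex_on D g" and grad: "has_gradient_on g gz D"
    and w_in: "\<And>s. s \<in> T \<Longrightarrow> w s \<in> D" and t: "t \<in> T"
    and cont: "continuous (at t within T) w"
    and deriv: "((\<lambda>s. gz (w s)) has_vector_derivative p) (at t within T)"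
  shows "((\<lambda>s. bregman_divergence g gz y (w s)) has_real_derivative - inner p (y - w t))
           (at t within T)"
proof -
  let ?d = "bregman_divergence g gz"
  define q where "q s = (gz (w s) - gz (w t)) /\<^sub>R (s - t)" for s
  have q: "(q \<longlongrightarrow> p) (at t within T)"
    unfolding q_def by (rule has_vector_derivative_imp_quotient_tendsto[OF deriv])
  have w: "((\<lambda>s. w s - w t) \<longlongrightarrow> 0) (at t within T)"
    using cont by (simp add: continuous_within LIM_zero)
  have bound: "((\<lambda>s. \<bar>inner (q s) (w s - w t)\<bar>) \<longlongrightarrow> 0) (at t within T)"
    using tendsto_rabs[OF tendsto_inner[OF q w]] by simp
  have "\<forall>\<^sub>F s in at t within T. norm (?d (w t) (w s) / (s - t)) \<le> \<bar>inner (q s) (w s - w t)\<bar>"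
    unfolding eventually_at_topological
  proof (intro exI[of _ UNIV] conjI ballI impI)
    fix s
    assume s: "s \<in> T"
    have "0 \<le> ?d (w t) (w s)" "0 \<le> ?d (w s) (w t)"
      using bregman_divergence_nonneg[OF convex grad] w_in s t by auto
    then have "\<bar>?d (w t) (w s)\<bar> \<le> \<bar>inner (gz (w s) - gz (w t)) (w s - w t)\<bar>"
      using bregman_divergence_symmetrized[of g gz "w t" "w s"] by linarith
    then show "norm (?d (w t) (w s) / (s - t)) \<le> \<bar>inner (q s) (w s - w t)\<bar>"
      by (simp add: q_def abs_mult divide_inverse mult.commute mult_left_mono)
  qed auto
  from Lim_null_comparison[OF this bound]
  have "((\<lambda>s. ?d (w t) (w s) / (s - t)) \<longlongrightarrow> 0) (at t within T)" .
  then have "((\<lambda>s. ?d (w t) (w s) / (s - t) - inner (q s) (y - w t)) \<longlongrightarrow> 0 - inner p (y - w t))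
               (at t within T)"
    by (intro tendsto_intros q)
  moreover have "(?d y (w s) - ?d y (w t)) / (s - t) =
      ?d (w t) (w s) / (s - t) - inner (q s) (y - w t)" for s
    by (simp add: bregman_divergence_three_points q_def divide_inverse
        right_diff_distrib mult.commute)
  ultimately show ?thesis
    by (simp add: has_field_derivative_iff)
qed

lemma has_gradient_on_along_curve:
  assumes grad: "has_gradient_on F G S"
    and z: "(z has_vector_derivative v) (at t within T)"
    and in_S: "\<And>s. s \<in> T \<Longrightarrow> z s \<in> S" and t: "t \<in> T"
  shows "((\<lambda>s. F (z s)) has_real_derivative inner (G (z t)) v) (at t within T)"
proof -
  have "(F has_derivative inner (G (z t))) (at (z t) within S)"
    using grad in_S[OF t] by (simp add: has_gradient_on_def)
  then have "(F has_derivative inner (G (z t))) (at (z t) within z ` T)"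
    by (rule has_derivative_subset) (use in_S in auto)
  from diff_chain_within[OF z[unfolded has_vector_derivative_def] this] show ?thesis
    by (simp add: has_field_derivative_def o_def mult_commute_abs)
qed

lemma has_real_derivative_integral_from_0:
  fixes \<phi> :: "real \<Rightarrow> real"
  assumes cont: "continuous_on {0..} \<phi>" and t: "0 \<le> t"
  shows "((\<lambda>s. integral {0..s} \<phi>) has_real_derivative \<phi> t) (at t within {0..})"
proof -
  have "((\<lambda>s. integral {0..s} \<phi>) has_real_derivative \<phi> t) (at t within {0..t + 1})"
    using t by (intro integral_has_real_derivative continuous_on_subset[OF cont]) auto
  moreover have "at t within {0..t + 1} = at t within {0..}"
    by (rule at_within_nhd[of _ "{..<t + 1}"]) auto
  ultimately show ?thesis
    by simp
qed

theorem bregman_algorithm_convergence_rate: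
  fixes P g :: "'a::real_inner \<Rightarrow> real"
  assumes P_gradient: "has_gradient_on P Pz Z"
    and P_convex: "convex_on Z P"
    and x: "x \<in> Z" "x \<in> D"
    and g_convex: "convex_on D g"
    and g_gradient: "has_gradient_on g gz D"
    and alpha_continuous: "continuous_on {0..} \<alpha>"
    and beta: "\<And>t. t \<ge> 0 \<Longrightarrow> \<beta> t = \<beta> 0 + integral {0..t} (\<lambda>s. exp (\<alpha> s))"
    and algorithm: "bregman_algorithm Z D gz Pz \<alpha> \<beta> z0 z zdot"
    and velocity_continuous: "continuous_on {0..} zdot"
    and t: "0 \<le> t"
  shows "P (z t) - P x \<le> exp (- \<beta> t) *
    (bregman_divergence g gz x (z0 + exp (- \<alpha> 0) *\<^sub>R zdot 0) + exp (\<beta> 0) * (P (z 0) - P x))"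
proof -
  define w where "w s = z s + exp (- \<alpha> s) *\<^sub>R zdot s" for s
  define V where "V s = bregman_divergence g gz x (w s) + exp (\<beta> s) * (P (z s) - P x)" for s
  have z0: "z 0 = z0"
    and z_in: "\<And>s. s \<in> {0..} \<Longrightarrow> z s \<in> Z" and w_in: "\<And>s. s \<in> {0..} \<Longrightarrow> w s \<in> D"
    and z': "\<And>s. s \<in> {0..} \<Longrightarrow> (z has_vector_derivative zdot s) (at s within {0..})"
    and gz': "\<And>s. s \<in> {0..} \<Longrightarrow> ((\<lambda>s. gz (w s)) has_vector_derivative
           - exp (\<alpha> s + \<beta> s) *\<^sub>R Pz (z s)) (at s within {0..})"
    using algorithm by (auto simp: bregman_algorithm_def w_def)
  have "continuous_on {0..} z"
    using z' by (rule continuous_on_vector_derivative)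
  then have w_cont: "continuous_on {0..} w"
    unfolding w_def by (intro continuous_intros alpha_continuous velocity_continuous)
  have beta': "(\<beta> has_real_derivative exp (\<alpha> s)) (at s within {0..})" if s: "s \<in> {0..}" for s
  proof -
    have "((\<lambda>s. \<beta> 0 + integral {0..s} (\<lambda>s. exp (\<alpha> s))) has_real_derivative 0 + exp (\<alpha> s))
            (at s within {0..})"
      using s by (intro DERIV_add DERIV_const has_real_derivative_integral_from_0
          continuous_intros alpha_continuous) auto
    then have "((\<lambda>s. \<beta> 0 + integral {0..s} (\<lambda>s. exp (\<alpha> s))) has_real_derivative exp (\<alpha> s))
            (at s within {0..})"
      by simp
    then show ?thesis
      by (rule has_field_derivative_transform_within[OF _ zero_less_one s]) (simp add: beta[symmetric])
  qed
  have V': "(V has_real_derivative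
      exp (\<alpha> s + \<beta> s) * (P (z s) + inner (Pz (z s)) (x - z s) - P x)) (at s within {0..})"
    if s: "s \<in> {0..}" for s
  proof -
    have "((\<lambda>s. bregman_divergence g gz x (w s)) has_real_derivative
        - inner (- exp (\<alpha> s + \<beta> s) *\<^sub>R Pz (z s)) (x - w s)) (at s within {0..})"
      using w_cont s
      by (intro bregman_divergence_has_derivative[OF g_convex g_gradient w_in s _ gz'])
        (auto simp: continuous_on_eq_continuous_within)
    moreover have "((\<lambda>s. P (z s)) has_real_derivative inner (Pz (z s)) (zdot s)) (at s within {0..})"
      using has_gradient_on_along_curve[OF P_gradient z'[OF s] z_in s] .
    ultimately have derivative: "(V has_real_derivative
        - inner (- exp (\<alpha> s + \<beta> s) *\<^sub>R Pz (z s)) (x - w s) +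
        (exp (\<beta> s) * exp (\<alpha> s) * (P (z s) - P x) + inner (Pz (z s)) (zdot s) * exp (\<beta> s)))
        (at s within {0..})"
      unfolding V_def using beta'[OF s] by (auto intro!: derivative_eq_intros)
    \<comment> \<open>Since \<open>w - z = exp (- \<alpha>) z'\<close>, the second term on the right is exactly what cancels the
      contribution of the derivative of \<open>P \<circ> z\<close> to \<open>V'\<close>; this is why the weight of
      \<open>P z - P x\<close> in \<open>V\<close> is \<open>exp \<beta>\<close>.\<close>
    have "- inner (- exp (\<alpha> s + \<beta> s) *\<^sub>R Pz (z s)) (x - w s) =
        exp (\<alpha> s + \<beta> s) * inner (Pz (z s)) (x - z s) - exp (\<beta> s) * inner (Pz (z s)) (zdot s)"
    proof -
      have "exp (- \<alpha> s) * exp (\<alpha> s + \<beta> s) = exp (\<beta> s)"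
        by (simp flip: exp_add)
      then show ?thesis
        by (simp add: w_def inner_diff_right inner_add_right right_diff_distrib distrib_left)
    qed
    from derivative[unfolded this] show ?thesis
      by (simp add: exp_add algebra_simps)
  qed
  have V'_nonpos: "exp (\<alpha> s + \<beta> s) * (P (z s) + inner (Pz (z s)) (x - z s) - P x) \<le> 0"
    if "s \<in> {0..}" for s
    using convex_on_above_tangent[OF P_convex P_gradient z_in[OF that] x(1)]
    by (simp add: mult_le_0_iff)
  have "V t \<le> V 0"
  proof (rule DERIV_nonpos_imp_decreasing_open[OF t])
    fix s :: real
    assume s: "0 < s" "s < t"
    then have "at s within {0..} = at s"
      by (intro at_within_interior) (simp add: interior_Ici[of "- 1"])
    then show "\<exists>y. (V has_real_derivative y) (at s) \<and> y \<le> 0"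
      using V'[of s] V'_nonpos[of s] s by auto
  next
    have "continuous_on {0..} V"
      using V' by (rule DERIV_continuous_on)
    then show "continuous_on {0..t} V"
      by (rule continuous_on_subset) auto
  qed
  moreover have "exp (\<beta> t) * (P (z t) - P x) \<le> V t"
    using bregman_divergence_nonneg[OF g_convex g_gradient w_in x(2)] t by (simp add: V_def)
  ultimately have "exp (\<beta> t) * (P (z t) - P x) \<le> V 0"
    by simp
  then have "exp (- \<beta> t) * (exp (\<beta> t) * (P (z t) - P x)) \<le> exp (- \<beta> t) * V 0"
    by (rule mult_left_mono) simp
  moreover have "exp (- \<beta> t) * (exp (\<beta> t) * (P (z t) - P x)) = P (z t) - P x"
    by (simp add: exp_minus)
  ultimately show ?thesis
    by (simp add: V_def w_def z0)
qed

theorem proposition4: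
  fixes M :: "'w measure"
    and f :: "real \<Rightarrow> ereal"
    and \<rho> :: real
    and owner :: "'d::finite \<Rightarrow> 'n::finite"
    and A :: "'n \<Rightarrow> (real^'d) set"
    and l :: "'n \<Rightarrow> real^'d \<Rightarrow> 'w \<Rightarrow> real"
    and P g :: "('d, 'n) variable \<Rightarrow> real"
    and Pz gz :: "('d, 'n) variable \<Rightarrow> ('d, 'n) variable"
    and D :: "('d, 'n) variable set"
    and zmin z0 :: "('d, 'n) variable"
    and z zdot :: "real \<Rightarrow> ('d, 'n) variable"
    and \<alpha> \<beta> :: "real \<Rightarrow> real"
    and c0 :: real
  assumes game: "robust_game M f \<rho> owner A l"
    and potential: "best_response_pseudo_potential M f \<rho> owner A l P"
    and P_gradient: "has_gradient_on P Pz (feasible owner A)"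
    and minimizer: "is_arg_min P (\<lambda>y. y \<in> feasible owner A) zmin"
    and g_domain: "feasible owner A \<subseteq> D"
    and g_convex: "strictly_convex_on D g"
    and g_gradient: "has_gradient_on g gz D"
    and alpha_continuous: "continuous_on {0..} \<alpha>"
    and beta: "\<And>t. t \<ge> 0 \<Longrightarrow> \<beta> t = \<beta> 0 + integral {0..t} (\<lambda>s. exp (\<alpha> s))"
    and beta_0: "\<beta> 0 \<ge> 0"
    and algorithm: "bregman_algorithm (feasible owner A) D gz Pz \<alpha> \<beta> z0 z zdot"
    and velocity_continuous: "continuous_on {0..} zdot"
    and P_convex: "convex_on (feasible owner A) P"
    and c0: "c0 = bregman_divergence g gz zmin (z0 + exp (- \<alpha> 0) *\<^sub>R zdot 0) +
                  exp (\<beta> 0) * (P (z 0) - P zmin)"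
  shows "\<forall>t\<ge>0. 0 \<le> P (z t) - P zmin \<and> P (z t) - P zmin \<le> exp (- \<beta> t) * c0"
proof (intro allI impI conjI)
  fix t :: real
  assume t: "0 \<le> t"
  have zmin: "zmin \<in> feasible owner A"
    using minimizer by (simp add: is_arg_min_def)
  have "z t \<in> feasible owner A"
    using algorithm t by (simp add: bregman_algorithm_def)
  then show "0 \<le> P (z t) - P zmin"
    using minimizer by (simp add: is_arg_min_linorder del: split_paired_All)
  show "P (z t) - P zmin \<le> exp (- \<beta> t) * c0"
    unfolding c0 using zmin g_domain
    by (intro bregman_algorithm_convergence_rate[OF P_gradient P_convex _ _
          convex_on_if_strictly_convex_on[OF g_convex] g_gradient alpha_continuous beta algorithm
          velocity_continuous t]) auto
qed

end
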